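(* Let $A\in(1,2]$ and $n\in\mathbb{N}$ ($n\ge 1$). If $f\in\mathcal{S}_0^{(n)}$, then $\operatorname{Re}\left(T_f(z)\right)>0$ for $|z|<R_{n,\mathrm{Co}(A)}$, where $R_{n,\mathrm{Co}(A)}$ is the least value of $r\in(0,1)$ satisfying $\Phi_1(r)=0$ with $$\Phi_1(r):=\frac{A+1}{2}\left(\frac{1-r}{1+r}\right)-\frac{1+2(n+1)r^n+r^{2n}}{1-r^{2n}}.$$ The radius $R_{n,\mathrm{Co}(A)}$ is sharp, i.e. for no $R'\in(R_{n,\mathrm{Co}(A)},1]$ is it true that every $f\in\mathcal{S}_0^{(n)}$ satisfies $\operatorname{Re}\left(T_f(z)\right)>0$ for all $|z|<R'$.
   Context: $\mathbb{D}=\{z\in\mathbb{C}:|z|<1\}$. $\mathcal{A}$ is the class of functions $f$ analytic in $\mathbb{D}$ with $f(0)=0$ and $f'(0)=1$. For analytic functions $f,g$ on $\mathbb{D}$, $f\prec g$ ($f$ is subordinate to $g$) means that there is an analytic $\omega:\mathbb{D}\to\mathbb{C}$ with $\omega(0)=0$, $|\omega(z)|<1$ and $f(z)=g(\omega(z))$ for all $z\in\mathbb{D}$. For $n\in\mathbb{N}$, $P_n$ is the class of analytic functions $p$ on $\mathbb{D}$ of the form $p(z)=1+c_nz^n+c_{n+1}z^{n+1}+\cdots$ with $p(z)\prec\frac{1+z}{1-z}$. The class $\mathcal{S}_0^{(n)}$ consists of all $f\in\mathcal{A}$ such that $zf'(z)/f(z)\in P_n$. For $A\in(1,2]$ and $f\in\mathcal{A}$,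 $$T_f(z)=\frac{2}{A-1}\left(\frac{A+1}{2}\cdot\frac{1+z}{1-z}-1-z\frac{f''(z)}{f'(z)}\right).$$ The radius of concavity (with respect to $\mathrm{Co}(A)$) of a class $\mathcal{F}\subset\mathcal{A}$ is the largest $R\in(0,1]$ such that every $f\in\mathcal{F}$ satisfies $\operatorname{Re}(T_f(z))>0$ for all $|z|<R$. *)

theory Defs
  imports "HOL-Complex_Analysis.Complex_Analysis"
begin

abbreviation unit_disc :: "complex set" ("\<D>")
  where "\<D> \<equiv> ball 0 1"

text \<open>Functions on the unit disc are represented by total functions on the complex plane; since the
  disc is open, every notion below depends only on the values inside it.\<close>

definition class_A :: "(complex \<Rightarrow> complex) set"
  where "class_A = {f. f holomorphic_on \<D> \<and> f 0 = 0 \<and> deriv f 0 = 1}"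

definition subordinate :: "(complex \<Rightarrow> complex) \<Rightarrow> (complex \<Rightarrow> complex) \<Rightarrow> bool"  (infix "\<prec>\<^sub>\<D>" 50)
  where "f \<prec>\<^sub>\<D> g \<longleftrightarrow>
    (\<exists>\<omega>. \<omega> holomorphic_on \<D> \<and> \<omega> 0 = 0 \<and> (\<forall>z\<in>\<D>. norm (\<omega> z) < 1 \<and> f z = g (\<omega> z)))"

definition class_P :: "nat \<Rightarrow> (complex \<Rightarrow> complex) set"
  where "class_P n = {p. p holomorphic_on \<D>
    \<and> (\<exists>c :: nat \<Rightarrow> complex. \<forall>z\<in>\<D>. (\<lambda>k. c (n + k) * z ^ (n + k)) sums (p z - 1))
    \<and> p \<prec>\<^sub>\<D> (\<lambda>z. (1 + z) / (1 - z))}"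

text \<open>The quotient \<open>z f'(z) / f(z)\<close> has a removable singularity at \<open>0\<close>, where its
  limit is \<open>1\<close> because \<open>f 0 = 0\<close> and \<open>f' 0 = 1\<close>. Elsewhere in the disc, \<open>f\<close> must not vanish for the
  quotient to be analytic; this is stated explicitly because division by zero is total in HOL.\<close>

definition class_S0 :: "nat \<Rightarrow> (complex \<Rightarrow> complex) set"
  where "class_S0 n = {f \<in> class_A. (\<forall>z\<in>\<D> - {0}. f z \<noteq> 0)
    \<and> (\<lambda>z. if z = 0 then 1 else z * deriv f z / f z) \<in> class_P n}"

definition T :: "real \<Rightarrow> (complex \<Rightarrow> complex) \<Rightarrow> complex \<Rightarrow> complex"
  where "T A f z = 2 / (of_real A - 1) *
    ((of_real A + 1) / 2 * ((1 + z) / (1 - z)) - 1 - z * (deriv (deriv f) z / deriv f z))"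

definition \<Phi>\<^sub>1 :: "real \<Rightarrow> nat \<Rightarrow> real \<Rightarrow> real"
  where "\<Phi>\<^sub>1 A n r = (A + 1) / 2 * ((1 - r) / (1 + r))
    - (1 + 2 * (real n + 1) * r ^ n + r ^ (2 * n)) / (1 - r ^ (2 * n))"

definition R_Co :: "nat \<Rightarrow> real \<Rightarrow> real"
  where "R_Co n A = (LEAST r. r \<in> {0<..<1} \<and> \<Phi>\<^sub>1 A n r = 0)"

end

theory Submission
  imports Defs
begin

text \<open>With \<open>p = z f' / f\<close> one has \<open>1 + z f'' / f' = p + z p' / p\<close>, and \<open>p = (1 + \<omega>) / (1 - \<omega>)\<close> where
  \<open>\<omega> = z\<^sup>n \<phi>\<close> and \<open>|\<phi>| \<le> 1\<close>. The Schwarz-Pick inequality for \<open>\<phi>\<close> gives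
  \<open>|z p' / p| = |2 z \<omega>' / (1 - \<omega>\<^sup>2)| \<le> 2 n r\<^sup>n / (1 - r\<^bsup>2n\<^esup>)\<close>, while \<open>|p| \<le> (1 + r\<^sup>n) / (1 - r\<^sup>n)\<close>; the sum of
  these bounds is the fraction in \<open>\<Phi>\<^sub>1\<close>. Sharpness comes from \<open>f(z) = z (1 - (-z)\<^sup>n)\<^bsup>-2/n\<^esup>\<close>, for which all
  the estimates are equalities at \<open>z = -r\<close>.\<close>

section \<open>Schwarz-Pick inequality and removal of a factor \<open>z ^ n\<close>\<close>

text \<open>Composing \<open>f\<close> with the disc automorphisms that send \<open>0\<close> to
  \<open>a\<close> and \<open>f a\<close> to \<open>0\<close> gives a self-map of the disc fixing
  \<open>0\<close>. The Schwarz lemma bounds its derivative there, and the chain rule turns this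
  into the claim.\<close>

lemma Schwarz_Pick_deriv_strict:
  assumes hol: "f holomorphic_on ball 0 1"
    and lt1: "\<And>z. norm z < 1 \<Longrightarrow> norm (f z) < 1"
    and a: "norm a < 1"
  shows "norm (deriv f a) * (1 - (norm a)\<^sup>2) \<le> 1 - (norm (f a))\<^sup>2"
proof -
  have pos: "1 - (norm w)\<^sup>2 > 0" if "norm w < 1" for w :: complex
    using that by (simp add: power_less_one_iff abs_square_less_1)
  have cnj: "cnj w * w = (of_real (norm w))\<^sup>2" "w * cnj w = (of_real (norm w))\<^sup>2" for w
    by (metis complex_norm_square mult.commute of_real_power)+
  define g where "g = Moebius_function 0 (f a) \<circ> f \<circ> Moebius_function 0 (-a)"
  have M: "Moebius_function 0 (-a) 0 = a"
    by (simp add: Moebius_function_of_zero)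
  have na: "norm (-a) < 1" using a by simp
  have "f \<circ> Moebius_function 0 (-a) holomorphic_on ball 0 1"
    using Moebius_function_norm_lt_1[OF na]
    by (intro holomorphic_on_compose_gen[OF Moebius_function_holomorphic[OF na] hol]) auto
  then have "g holomorphic_on ball 0 1"
    unfolding g_def o_assoc[symmetric]
    using Moebius_function_norm_lt_1[OF na] lt1
    by (intro holomorphic_on_compose_gen[OF _ Moebius_function_holomorphic[OF lt1[OF a]]]) auto
  moreover have "g 0 = 0"
    by (simp add: g_def M Moebius_function_eq_zero)
  moreover have "norm (g z) < 1" if "norm z < 1" for z
    using that by (auto simp: g_def intro!: Moebius_function_norm_lt_1 lt1 a)
  ultimately have le1: "norm (deriv g 0) \<le> 1"
    using Schwarz_Lemma(2)[of g 0] by simp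
  have d1: "(Moebius_function 0 (-a) has_field_derivative of_real (1 - (norm a)\<^sup>2)) (at 0)"
    unfolding Moebius_function_simple[abs_def]
    by (rule derivative_eq_intros refl | simp add: cnj)+
  have fa: "of_real (1 - (norm (f a))\<^sup>2) \<noteq> (0::complex)"
    using pos[OF lt1[OF a]] by (metis of_real_eq_0_iff less_irrefl)
  have d2: "(Moebius_function 0 (f a) has_field_derivative 1 / of_real (1 - (norm (f a))\<^sup>2)) (at (f a))"
    unfolding Moebius_function_simple[abs_def]
    using fa by (auto intro!: derivative_eq_intros simp: cnj divide_simps)
  have "(f has_field_derivative deriv f a) (at a)"
    using hol a by (simp add: holomorphic_derivI)
  then have "(g has_field_derivative
      1 / of_real (1 - (norm (f a))\<^sup>2) * deriv f a * of_real (1 - (norm a)\<^sup>2)) (at 0)"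
    unfolding g_def using d1 d2 by (intro DERIV_chain) (simp_all only: M)
  then have "deriv g 0 = deriv f a * of_real (1 - (norm a)\<^sup>2) / of_real (1 - (norm (f a))\<^sup>2)"
    by (simp add: DERIV_imp_deriv)
  then have "norm (deriv g 0) = norm (deriv f a) * (1 - (norm a)\<^sup>2) / (1 - (norm (f a))\<^sup>2)"
    using pos[OF a] pos[OF lt1[OF a]] by (simp only: norm_divide norm_mult norm_of_real abs_of_pos)
  with le1 pos[OF lt1[OF a]] show ?thesis
    by (simp add: divide_le_eq)
qed

text \<open>The strict version applies to \<open>c * f\<close> for \<open>0 < c < 1\<close>; then
  \<open>c\<close> tends to \<open>1\<close>. The weak bound on \<open>f\<close> admits unimodular
  constants, which is the cofactor of the extremal function.\<close>

lemma Schwarz_Pick_deriv: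
  assumes hol: "f holomorphic_on ball 0 1"
    and le1: "\<And>z. norm z < 1 \<Longrightarrow> norm (f z) \<le> 1"
    and a: "norm a < 1"
  shows "norm (deriv f a) * (1 - (norm a)\<^sup>2) \<le> 1 - (norm (f a))\<^sup>2"
proof -
  have "c * norm (deriv f a) * (1 - (norm a)\<^sup>2) \<le> 1 - (c * norm (f a))\<^sup>2"
    if c: "c \<in> {0<..<1}" for c :: real
  proof -
    have "norm (of_real c * f z) < 1" if "norm z < 1" for z
      using c le1[OF that] by (simp add: norm_mult)
        (metis mult_left_le mult.commute norm_ge_zero order_le_less_trans less_eq_real_def)
    then have "norm (deriv (\<lambda>z. of_real c * f z) a) * (1 - (norm a)\<^sup>2) \<le> 1 - (norm (of_real c * f a))\<^sup>2"
      by (intro Schwarz_Pick_deriv_strict holomorphic_intros hol a)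
    moreover have "deriv (\<lambda>z. of_real c * f z) a = of_real c * deriv f a"
      using hol a by (intro deriv_cmult) (auto simp: holomorphic_on_imp_differentiable_at)
    ultimately show ?thesis
      using c by (simp add: norm_mult)
  qed
  then have ev: "\<forall>\<^sub>F c in at_left 1. c * norm (deriv f a) * (1 - (norm a)\<^sup>2) \<le> 1 - (c * norm (f a))\<^sup>2"
    by (intro eventually_at_leftI[of 0]) auto
  have "((\<lambda>c::real. c * norm (deriv f a) * (1 - (norm a)\<^sup>2)) \<longlongrightarrow> 1 * norm (deriv f a) * (1 - (norm a)\<^sup>2)) (at_left 1)"
    by (intro tendsto_intros)
  moreover have "((\<lambda>c::real. 1 - (c * norm (f a))\<^sup>2) \<longlongrightarrow> 1 - (1 * norm (f a))\<^sup>2) (at_left 1)"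
    by (intro tendsto_intros)
  ultimately show ?thesis
    using tendsto_le[OF trivial_limit_at_left_real _ _ ev] by simp
qed

text \<open>On the circle of radius \<open>\<rho>\<close> the hypothesis gives
  \<open>norm (\<phi> z) \<le> 1 / \<rho> ^ n\<close>; the maximum principle carries this to
  \<open>a\<close>, and \<open>\<rho>\<close> tends to \<open>1\<close>.\<close>

lemma norm_cofactor_le_1:
  assumes hol: "\<phi> holomorphic_on ball 0 1"
    and lt1: "\<And>z. norm z < 1 \<Longrightarrow> norm (z ^ n * \<phi> z) < 1"
    and a: "norm a < 1"
  shows "norm (\<phi> a) \<le> 1"
proof -
  have "norm (\<phi> a) * \<rho> ^ n \<le> 1" if \<rho>: "\<rho> \<in> {norm a<..<1}" for \<rho>
  proof -
    have \<rho>0: "\<rho> > 0" using \<rho> by (smt (verit) greaterThanLessThan_iff norm_ge_zero)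
    have "norm (\<phi> a) \<le> 1 / \<rho> ^ n"
    proof (rule maximum_modulus_frontier[of \<phi> "cball 0 \<rho>"])
      show "\<phi> holomorphic_on interior (cball 0 \<rho>)"
        using \<rho> by (intro holomorphic_on_subset[OF hol]) auto
      show "continuous_on (closure (cball 0 \<rho>)) \<phi>"
        using \<rho> by (intro holomorphic_on_imp_continuous_on holomorphic_on_subset[OF hol]) auto
      show "norm (\<phi> z) \<le> 1 / \<rho> ^ n" if "z \<in> frontier (cball 0 \<rho>)" for z
      proof -
        have "norm z = \<rho>" using that \<rho>0 by simp
        then show ?thesis
          using lt1[of z] \<rho> \<rho>0 by (simp add: norm_mult norm_power field_simps)
      qed
    qed (use \<rho> in auto)
    then show ?thesis using \<rho>0 by (simp add: field_simps)
  qed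
  then have ev: "\<forall>\<^sub>F \<rho> in at_left 1. norm (\<phi> a) * \<rho> ^ n \<le> 1"
    using a by (intro eventually_at_leftI[of "norm a"]) auto
  have "((\<lambda>\<rho>::real. norm (\<phi> a) * \<rho> ^ n) \<longlongrightarrow> norm (\<phi> a) * 1 ^ n) (at_left 1)"
    by (intro tendsto_intros)
  from tendsto_upperbound[OF this ev] show ?thesis by simp
qed

section \<open>Real inequalities behind the bound on \<open>z * \<omega>'\<close>\<close>

text \<open>Cancelling \<open>1 - r^2\<close> leaves
  \<open>r * (1 + t) * S \<le> n * (1 + q * t)\<close>, with \<open>S\<close> the geometric sum and
  \<open>q = r ^ (2 * n)\<close>. This is affine in \<open>t\<close>, so the cases
  \<open>t = 0\<close> and \<open>t = 1\<close> suffice: these are facts \<open>1\<close> and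
  \<open>2\<close>.\<close>

lemma geometric_sum_bound:
  fixes r t :: real
  assumes r: "0 \<le> r" "r < 1" and t: "0 \<le> t" "t \<le> 1"
  shows "r * (1 + t) * (1 - r ^ (2 * n)) \<le> n * (1 + r ^ (2 * n) * t) * (1 - r\<^sup>2)"
proof -
  define S where "S = (\<Sum>k<n. (r\<^sup>2) ^ k)"
  define q where "q = r ^ (2 * n)"
  have q: "1 - q = (1 - r\<^sup>2) * S"
    unfolding S_def q_def by (simp add: one_diff_power_eq power_mult)
  have "r * S \<le> (\<Sum>k<n. 1)"
    unfolding S_def sum_distrib_left using r
    by (intro sum_mono) (simp add: mult_le_one power_le_one flip: power_mult)
  then have 1: "r * S \<le> n" by simp
  \<comment> \<open>Pairing the summands \<open>k\<close> and \<open>n - 1 - k\<close>: their product is \<open>q\<close>, so their sum is at most \<open>1 + q\<close>.\<close>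
  have "2 * (r * S) = (\<Sum>k<n. r * (r\<^sup>2) ^ k) + (\<Sum>k<n. r * (r\<^sup>2) ^ (n - Suc k))"
    unfolding S_def sum_distrib_left sum.nat_diff_reindex[of "\<lambda>k. r * (r\<^sup>2) ^ k"]
    by (simp flip: sum_distrib_left)
  also have "\<dots> = (\<Sum>k<n. r ^ (2 * k + 1) + r ^ (2 * (n - Suc k) + 1))"
    by (simp add: sum.distrib power_mult)
  also have "\<dots> \<le> (\<Sum>k<n. 1 + q)"
  proof (rule sum_mono)
    fix k assume "k \<in> {..<n}"
    define x y where "x = r ^ (2 * k + 1)" and "y = r ^ (2 * (n - Suc k) + 1)"
    have "x \<le> 1" "y \<le> 1"
      unfolding x_def y_def using r by (simp_all only: power_le_one less_imp_le)
    then have "0 \<le> (1 - x) * (1 - y)" by simp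
    moreover have "x * y = q"
      unfolding x_def y_def q_def power_add[symmetric]
      using \<open>k \<in> {..<n}\<close> by (intro arg_cong[where f = "power r"]) auto
    ultimately show "x + y \<le> 1 + q" by (simp add: algebra_simps)
  qed
  finally have 2: "2 * (r * S) \<le> n * (1 + q)" by simp
  have "0 \<le> (1 - t) * (n - r * S) + t * (n * (1 + q) - 2 * (r * S))"
    using 1 2 t by (intro add_nonneg_nonneg mult_nonneg_nonneg) auto
  also have "\<dots> = n * (1 + q * t) - r * (1 + t) * S"
    by (simp add: algebra_simps)
  finally have "(r * (1 + t) * S) * (1 - r\<^sup>2) \<le> n * (1 + q * t) * (1 - r\<^sup>2)"
    using r by (intro mult_right_mono) (auto simp: power_le_one)
  then show ?thesis
    unfolding q_def[symmetric] q by (simp add: algebra_simps)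
qed

text \<open>Here \<open>r\<close>, \<open>t\<close>, \<open>d\<close> stand for the moduli of
  \<open>z\<close>, \<open>\<phi> z\<close> and \<open>deriv \<phi> z\<close>. The right side is the
  left side at \<open>t = 1\<close>, \<open>d = 0\<close>, so the worst cofactor is a unimodular
  constant. After cross-multiplication both sides carry a factor \<open>1 - t\<close>, and
  \<open>geometric_sum_bound\<close> handles the rest.\<close>

lemma cofactor_deriv_bound:
  fixes r t d :: real
  assumes r: "0 \<le> r" "r < 1" and t: "0 \<le> t" "t \<le> 1" and n: "n \<ge> 1"
    and d: "d * (1 - r\<^sup>2) \<le> 1 - t\<^sup>2"
  shows "(n * r ^ n * t + r ^ (n + 1) * d) / (1 - (r ^ n * t)\<^sup>2) \<le> n * r ^ n / (1 - r ^ (2 * n))"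
proof -
  define s where "s = r ^ n"
  have s: "0 \<le> s" "s < 1" and q: "r ^ (2 * n) = s\<^sup>2"
    unfolding s_def using r n by (auto simp: power_less_one_iff power_even_eq)
  have s2: "s\<^sup>2 < 1" using s by (simp add: abs_square_less_1)
  have r2: "1 - r\<^sup>2 > 0" using r by (simp add: abs_square_less_1)
  have "s * t \<le> s * 1" using s t by (intro mult_left_mono) auto
  then have st: "(s * t)\<^sup>2 < 1" using s t by (simp add: abs_square_less_1 abs_mult)
  have "r * d * (1 - s\<^sup>2) * (1 - r\<^sup>2) = r * (1 - s\<^sup>2) * (d * (1 - r\<^sup>2))"
    by simp
  also have "\<dots> \<le> r * (1 - s\<^sup>2) * (1 - t\<^sup>2)"
    using r s2 d by (intro mult_left_mono) auto
  also have "\<dots> = (1 - t) * (r * (1 + t) * (1 - s\<^sup>2))"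
    by (simp add: algebra_simps power2_eq_square)
  also have "\<dots> \<le> (1 - t) * (n * (1 + s\<^sup>2 * t) * (1 - r\<^sup>2))"
    using geometric_sum_bound[OF r t, of n] t unfolding q by (intro mult_left_mono) auto
  finally have "r * d * (1 - s\<^sup>2) * (1 - r\<^sup>2) \<le> ((1 - t) * (n * (1 + s\<^sup>2 * t))) * (1 - r\<^sup>2)"
    by (simp add: mult_ac)
  then have "r * d * (1 - s\<^sup>2) \<le> (1 - t) * (n * (1 + s\<^sup>2 * t))"
    using r2 by simp
  then have "s * (r * d * (1 - s\<^sup>2)) \<le> s * ((1 - t) * (n * (1 + s\<^sup>2 * t)))"
    using s by (intro mult_left_mono) auto
  \<comment> \<open>Uses
    \<open>(1 - t) * (1 + s^2 * t) = (1 - (s * t)^2) - t * (1 - s^2)\<close>.\<close>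
  then have "(n * s * t + s * r * d) * (1 - s\<^sup>2) \<le> n * s * (1 - (s * t)\<^sup>2)"
    by (simp add: algebra_simps power2_eq_square)
  then have "(n * s * t + s * r * d) / (1 - (s * t)\<^sup>2) \<le> n * s / (1 - s\<^sup>2)"
    using s2 st by (simp add: divide_le_eq le_divide_eq mult_ac)
  then show ?thesis
    unfolding q s_def[symmetric] by (simp add: s_def mult_ac)
qed

section \<open>Representation and estimates for functions in \<open>class_P\<close>\<close>

text \<open>Since \<open>\<omega> = (p - 1) * (1 - \<omega>) / 2\<close>, the zero of order at least
  \<open>n\<close> of \<open>p - 1\<close> at the origin passes to the Schwarz function.\<close>

lemma class_P_factor:
  assumes "p \<in> class_P n"
  obtains \<phi> where "\<phi> holomorphic_on \<D>"
    "\<And>z. z \<in> \<D> \<Longrightarrow> norm (z ^ n * \<phi> z) < 1"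
    "\<And>z. z \<in> \<D> \<Longrightarrow> p z = (1 + z ^ n * \<phi> z) / (1 - z ^ n * \<phi> z)"
proof -
  obtain c :: "nat \<Rightarrow> complex" and \<omega> where
    c: "\<And>z. z \<in> \<D> \<Longrightarrow> (\<lambda>k. c (n + k) * z ^ (n + k)) sums (p z - 1)"
    and \<omega>: "\<omega> holomorphic_on \<D>"
    and p: "\<And>z. z \<in> \<D> \<Longrightarrow> norm (\<omega> z) < 1 \<and> p z = (1 + \<omega> z) / (1 - \<omega> z)"
    using assms unfolding class_P_def subordinate_def by blast
  \<comment> \<open>Taking the series instead of the quotient \<open>(p z - 1) / z ^ n\<close> makes
    \<open>h\<close> holomorphic at \<open>0\<close> as well.\<close>
  define h where "h = (\<lambda>z. \<Sum>k. c (n + k) * z ^ k)"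
  have sums: "(\<lambda>k. c (n + k) * z ^ k) sums h z" if "z \<in> \<D>" for z
  proof (cases "z = 0")
    case True
    then show ?thesis
      unfolding h_def by (metis powser_sums_zero sums_unique)
  next
    case False
    have "(\<lambda>k. c (n + k) * z ^ (n + k) / z ^ n) sums ((p z - 1) / z ^ n)"
      by (intro sums_divide c that)
    then have "(\<lambda>k. c (n + k) * z ^ k) sums ((p z - 1) / z ^ n)"
      using False by (simp add: power_add)
    then show ?thesis
      unfolding h_def by (simp add: sums_iff)
  qed
  then have h: "h holomorphic_on \<D>"
    using power_series_holomorphic[of 0 1 "\<lambda>k. c (n + k)" h] by simp
  have ph: "p z - 1 = z ^ n * h z" if "z \<in> \<D>" for z
    using sums_mult[OF sums[OF that], of "z ^ n"] c[OF that]
    by (simp add: power_add mult_ac sums_unique2)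
  define \<phi> where "\<phi> = (\<lambda>z. h z * (1 - \<omega> z) / 2)"
  have "z ^ n * \<phi> z = \<omega> z" if "z \<in> \<D>" for z
  proof -
    have "\<omega> z \<noteq> 1" using p[OF that] by auto
    have "z ^ n * \<phi> z = (p z - 1) * (1 - \<omega> z) / 2"
      unfolding \<phi>_def ph[OF that] by simp
    also have "\<dots> = \<omega> z"
      using p[OF that] \<open>\<omega> z \<noteq> 1\<close> by (simp add: field_simps)
    finally show ?thesis .
  qed
  then show ?thesis
    using p by (intro that[of \<phi>]) (auto simp: \<phi>_def intro!: holomorphic_intros h \<omega>)
qed

lemma class_P_bound:
  assumes p: "p \<in> class_P n" and n: "n \<ge> 1" and z: "z \<in> \<D>"
  shows "p z \<noteq> 0"
    and "norm (p z + z * deriv p z / p z)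
      \<le> (1 + 2 * (real n + 1) * norm z ^ n + norm z ^ (2 * n)) / (1 - norm z ^ (2 * n))"
proof -
  obtain \<phi> where \<phi>: "\<phi> holomorphic_on \<D>"
    and lt1: "\<And>z. z \<in> \<D> \<Longrightarrow> norm (z ^ n * \<phi> z) < 1"
    and p_eq: "\<And>z. z \<in> \<D> \<Longrightarrow> p z = (1 + z ^ n * \<phi> z) / (1 - z ^ n * \<phi> z)"
    using class_P_factor[OF p] by metis
  define r where "r = norm z"
  define s where "s = r ^ n"
  define \<omega> where "\<omega> = z ^ n * \<phi> z"
  define \<omega>' where "\<omega>' = of_nat n * z ^ (n - 1) * \<phi> z + z ^ n * deriv \<phi> z"
  have r: "0 \<le> r" "r < 1" using z by (auto simp: r_def)
  have s: "0 \<le> s" "s < 1" and q: "r ^ (2 * n) = s\<^sup>2"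
    unfolding s_def using r n by (auto simp: power_less_one_iff power_even_eq)
  have s2: "s\<^sup>2 < 1" using s by (simp add: abs_square_less_1)
  have t: "norm (\<phi> z) \<le> 1"
    using norm_cofactor_le_1[OF \<phi>, of n z] lt1 z by auto
  have n\<omega>: "norm \<omega> = s * norm (\<phi> z)"
    by (simp add: \<omega>_def s_def r_def norm_mult norm_power)
  also have "\<dots> \<le> s * 1"
    using s t by (intro mult_left_mono) auto
  finally have \<omega>s: "norm \<omega> \<le> s" by simp
  have \<omega>1: "norm \<omega> < 1" using lt1[OF z] by (simp add: \<omega>_def)
  have ne: "1 - \<omega> \<noteq> 0" "1 + \<omega> \<noteq> 0"
    using \<omega>1 by (auto simp: add_eq_0_iff)
  have pz: "p z = (1 + \<omega>) / (1 - \<omega>)"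
    using p_eq[OF z] by (simp add: \<omega>_def)
  then show "p z \<noteq> 0" using ne by simp
  have d\<phi>: "(\<phi> has_field_derivative deriv \<phi> z) (at z)"
    using \<phi> z by (intro holomorphic_derivI) auto
  have d\<omega>: "((\<lambda>z. z ^ n * \<phi> z) has_field_derivative \<omega>') (at z)"
    unfolding \<omega>'_def by (rule derivative_eq_intros d\<phi> refl | simp add: algebra_simps)+
  have "((\<lambda>z. (1 + z ^ n * \<phi> z) / (1 - z ^ n * \<phi> z)) has_field_derivative 2 * \<omega>' / (1 - \<omega>)\<^sup>2) (at z)"
    by (rule DERIV_cong[OF DERIV_divide[OF DERIV_add[OF DERIV_const d\<omega>] DERIV_diff[OF DERIV_const d\<omega>]]];
      use ne in \<open>fold \<omega>_def, simp add: power2_eq_square algebra_simps\<close>)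
  then have "(p has_field_derivative 2 * \<omega>' / (1 - \<omega>)\<^sup>2) (at z)"
    by (rule has_field_derivative_transform_within_open[OF _ open_ball z]) (simp add: p_eq)
  then have dp: "deriv p z = 2 * \<omega>' / (1 - \<omega>)\<^sup>2"
    by (rule DERIV_imp_deriv)
  \<comment> \<open>The logarithmic derivative of \<open>(1 + \<omega>) / (1 - \<omega>)\<close> is
    \<open>\<omega>' / (1 + \<omega>) + \<omega>' / (1 - \<omega>)\<close>.\<close>
  have zp: "z * deriv p z / p z = 2 * (z * \<omega>') / (1 - \<omega>\<^sup>2)"
  proof -
    have "1 - \<omega>\<^sup>2 = (1 - \<omega>) * (1 + \<omega>)"
      by (simp add: power2_eq_square algebra_simps)
    then show ?thesis
      unfolding dp pz using ne by (simp add: divide_simps power2_eq_square)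
  qed
  have "z * z ^ (n - 1) = z ^ n" using n by (cases n) auto
  then have "z * \<omega>' = of_nat n * z ^ n * \<phi> z + z ^ (n + 1) * deriv \<phi> z"
    by (simp add: \<omega>'_def algebra_simps)
  then have z\<omega>': "norm (z * \<omega>') \<le> n * r ^ n * norm (\<phi> z) + r ^ (n + 1) * norm (deriv \<phi> z)"
    by (metis (no_types, lifting) norm_triangle_ineq norm_mult norm_power norm_of_nat r_def)
  have \<omega>2: "1 - (norm \<omega>)\<^sup>2 > 0" using \<omega>1 by (simp add: abs_square_less_1)
  have "norm (1 - \<omega>\<^sup>2) \<ge> 1 - (norm \<omega>)\<^sup>2"
    by (metis norm_one norm_power norm_triangle_ineq2)
  then have "norm (z * \<omega>') / norm (1 - \<omega>\<^sup>2) \<le>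
      (n * r ^ n * norm (\<phi> z) + r ^ (n + 1) * norm (deriv \<phi> z)) / (1 - (norm \<omega>)\<^sup>2)"
    using z\<omega>' \<omega>2 by (intro frac_le order_trans[OF norm_ge_zero z\<omega>']) auto
  \<comment> \<open>Schwarz-Pick for \<open>\<phi>\<close> at \<open>z\<close> is exactly the
    hypothesis on \<open>d\<close> in \<open>cofactor_deriv_bound\<close>.\<close>
  also have "\<dots> \<le> n * r ^ n / (1 - r ^ (2 * n))"
    unfolding n\<omega> s_def using Schwarz_Pick_deriv[OF \<phi>, of z] norm_cofactor_le_1[OF \<phi>, of n] lt1 z
    by (intro cofactor_deriv_bound r n t) (auto simp: r_def)
  finally have b1: "norm (z * deriv p z / p z) \<le> 2 * (n * s / (1 - s\<^sup>2))"
    unfolding zp q s_def[symmetric] by (simp add: norm_divide norm_mult)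
  have "norm (1 + \<omega>) \<le> 1 + s"
    using \<omega>s norm_triangle_ineq[of 1 \<omega>] by simp
  moreover have "norm (1 - \<omega>) \<ge> 1 - s"
    using \<omega>s norm_triangle_ineq2[of 1 \<omega>] by simp
  ultimately have "norm (p z) \<le> (1 + s) / (1 - s)"
    unfolding pz norm_divide using s by (intro frac_le) auto
  \<comment> \<open>Brings the bound on \<open>p z\<close> to the denominator of \<open>b1\<close>,
    so that the two can be added.\<close>
  also have "\<dots> = (1 + s)\<^sup>2 / (1 - s\<^sup>2)"
  proof -
    have "1 - s\<^sup>2 = (1 - s) * (1 + s)"
      by (simp add: power2_eq_square algebra_simps)
    then show ?thesis using s by (simp add: divide_simps power2_eq_square)
  qed
  finally have "norm (p z + z * deriv p z / p z) \<le> (1 + s)\<^sup>2 / (1 - s\<^sup>2) + 2 * (n * s / (1 - s\<^sup>2))"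
    using b1 norm_triangle_ineq[of "p z" "z * deriv p z / p z"] by linarith
  also have "\<dots> = ((1 + s)\<^sup>2 + 2 * (n * s)) / (1 - s\<^sup>2)"
    by (simp add: add_divide_distrib)
  also have "(1 + s)\<^sup>2 + 2 * (n * s) = 1 + 2 * (real n + 1) * s + s\<^sup>2"
    by (simp add: power2_eq_square algebra_simps)
  finally show "norm (p z + z * deriv p z / p z)
      \<le> (1 + 2 * (real n + 1) * norm z ^ n + norm z ^ (2 * n)) / (1 - norm z ^ (2 * n))"
    unfolding r_def[symmetric] q s_def[symmetric] .
qed

section \<open>\<open>T\<close> in terms of the starlike quotient, and the half-plane map\<close>

text \<open>Logarithmic differentiation of \<open>p = z f' / f\<close> gives
  \<open>z p' / p = 1 + z f'' / f' - p\<close>. Prescribing \<open>p\<close> only off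
  \<open>0\<close> lets it be either the quotient completed at \<open>0\<close> or a closed formula;
  \<open>p z \<noteq> 0\<close> ensures \<open>deriv f z \<noteq> 0\<close>.\<close>

lemma T_eq_starlike_quotient:
  assumes f: "f holomorphic_on \<D>" and z: "z \<in> \<D>" "z \<noteq> 0"
    and nz: "\<And>w. w \<in> \<D> - {0} \<Longrightarrow> f w \<noteq> 0"
    and p: "\<And>w. w \<in> \<D> - {0} \<Longrightarrow> p w = w * deriv f w / f w"
    and pz: "p z \<noteq> 0"
  shows "T A f z = 2 / (of_real A - 1) *
    ((of_real A + 1) / 2 * ((1 + z) / (1 - z)) - (p z + z * deriv p z / p z))"
proof -
  have fz: "f z \<noteq> 0" using nz z by simp
  have dfz: "deriv f z \<noteq> 0" using pz p[of z] z by auto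
  have df: "(f has_field_derivative deriv f z) (at z)"
    using f z by (intro holomorphic_derivI) auto
  have ddf: "(deriv f has_field_derivative deriv (deriv f) z) (at z)"
    using f z by (intro holomorphic_derivI[OF holomorphic_deriv]) auto
  have "((\<lambda>w. w * deriv f w / f w) has_field_derivative
      ((deriv f z + z * deriv (deriv f) z) * f z - z * deriv f z * deriv f z) / (f z * f z)) (at z)"
    using fz by (auto intro!: derivative_eq_intros df ddf simp: algebra_simps)
  then have "(p has_field_derivative
      ((deriv f z + z * deriv (deriv f) z) * f z - z * deriv f z * deriv f z) / (f z * f z)) (at z)"
    by (rule has_field_derivative_transform_within_open[where S = "\<D> - {0}"])
      (use z p in \<open>auto intro: open_delete\<close>)
  then have "deriv p z = ((deriv f z + z * deriv (deriv f) z) * f z - z * deriv f z * deriv f z) / (f z * f z)"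
    by (rule DERIV_imp_deriv)
  then have "p z + z * deriv p z / p z = 1 + z * (deriv (deriv f) z / deriv f z)"
    using z fz dfz unfolding p[OF DiffI[OF z(1)], simplified, OF z(2)]
    by (simp add: divide_simps) (simp add: algebra_simps)
  then show ?thesis
    unfolding T_def by simp
qed

text \<open>The real part is the Poisson kernel \<open>(1 - r^2) / (norm (1 - z))^2\<close> with
  \<open>r = norm z\<close>, smallest on the circle at \<open>z = -r\<close>.\<close>

lemma Re_halfplane_map_ge:
  assumes "norm z < 1"
  shows "(1 - norm z) / (1 + norm z) \<le> Re ((1 + z) / (1 - z))"
proof -
  define r where "r = norm z"
  have r: "0 \<le> r" "r < 1" using assms by (auto simp: r_def)
  have ne: "1 - z \<noteq> 0" using assms by auto
  have "Re ((1 + z) / (1 - z)) = (1 - r\<^sup>2) / (norm (1 - z))\<^sup>2"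
    by (simp add: Re_divide r_def cmod_power2 algebra_simps) (simp add: power2_eq_square algebra_simps)
  moreover have "norm (1 - z) \<le> 1 + r"
    using norm_triangle_ineq4[of 1 z] by (simp add: r_def)
  then have "(norm (1 - z))\<^sup>2 \<le> (1 + r)\<^sup>2" by (simp add: power_mono)
  then have "(1 - r\<^sup>2) / (norm (1 - z))\<^sup>2 \<ge> (1 - r\<^sup>2) / (1 + r)\<^sup>2"
    using r ne by (intro divide_left_mono) (auto simp: power_le_one)
  moreover have "(1 - r\<^sup>2) / (1 + r)\<^sup>2 = (1 - r) / (1 + r)"
  proof -
    have "1 - r\<^sup>2 = (1 - r) * (1 + r)"
      by (simp add: power2_eq_square algebra_simps)
    then show ?thesis using r by (simp add: power2_eq_square)
  qed
  ultimately show ?thesis by (simp add: r_def)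
qed

section \<open>The zero of \<open>\<Phi>\<^sub>1\<close>\<close>

text \<open>The half-plane term strictly decreases and the subtracted fraction does not decrease.
  This yields both uniqueness of the zero and positivity before it.\<close>

lemma Phi1_strict_antimono:
  assumes A: "A > 1" and n: "n \<ge> 1" and xy: "0 \<le> x" "x < y" "y < 1"
  shows "\<Phi>\<^sub>1 A n y < \<Phi>\<^sub>1 A n x"
proof -
  have p: "x ^ n \<le> y ^ n" "x ^ (2 * n) \<le> y ^ (2 * n)" "y ^ (2 * n) < 1"
    using xy n by (auto intro!: power_mono simp: power_less_one_iff)
  have "(1 + 2 * (real n + 1) * x ^ n + x ^ (2 * n)) / (1 - x ^ (2 * n))
      \<le> (1 + 2 * (real n + 1) * y ^ n + y ^ (2 * n)) / (1 - y ^ (2 * n))"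
    using p xy by (intro frac_le add_mono mult_left_mono add_nonneg_nonneg mult_nonneg_nonneg) auto
  moreover have "(A + 1) / 2 * ((1 - y) / (1 + y)) < (A + 1) / 2 * ((1 - x) / (1 + x))"
    using A xy by (intro mult_strict_left_mono frac_less) auto
  ultimately show ?thesis unfolding \<Phi>\<^sub>1_def by linarith
qed

lemma Phi1_root_exists:
  assumes A: "A > 1" and n: "n \<ge> 1"
  shows "\<exists>r\<in>{0<..<1}. \<Phi>\<^sub>1 A n r = 0"
proof -
  \<comment> \<open>This is \<open>\<Phi>\<^sub>1 A n r\<close> times
    \<open>(1 + r) * (1 - r ^ (2 * n))\<close>, which removes the pole at \<open>r = 1\<close>. Its
    end values are \<open>(A - 1) / 2\<close> and \<open>-4 * (n + 2)\<close>.\<close>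
  define \<psi> where "\<psi> = (\<lambda>r::real. (A + 1) / 2 * (1 - r) * (1 - r ^ (2 * n))
    - (1 + r) * (1 + 2 * (real n + 1) * r ^ n + r ^ (2 * n)))"
  have 0: "\<psi> 0 > 0" and 1: "\<psi> 1 < 0"
    using A n by (simp_all add: \<psi>_def power_0_left)
  have "\<exists>r\<ge>0. r \<le> 1 \<and> \<psi> r = 0"
    using 0 1 by (intro IVT2') (auto simp: \<psi>_def intro!: continuous_intros)
  then obtain r where r: "0 \<le> r" "r \<le> 1" "\<psi> r = 0" by auto
  then have "r \<noteq> 0" "r \<noteq> 1" using 0 1 by auto
  with r have r: "0 < r" "r < 1" "\<psi> r = 0" by auto
  have "r ^ (2 * n) < 1" using r n by (simp add: power_less_one_iff)
  then have "\<Phi>\<^sub>1 A n r = \<psi> r / ((1 + r) * (1 - r ^ (2 * n)))"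
    using r unfolding \<psi>_def \<Phi>\<^sub>1_def by (simp add: divide_simps)
  with r show ?thesis by auto
qed

text \<open>\<open>LEAST\<close> on the reals is informative only once a minimum is known to exist;
  here the zero in the unit interval is unique, so it is the value selected.\<close>

lemma R_Co_props:
  assumes A: "A > 1" and n: "n \<ge> 1"
  shows "R_Co n A \<in> {0<..<1}" "\<Phi>\<^sub>1 A n (R_Co n A) = 0"
    "\<And>r. r \<in> {0<..<1} \<Longrightarrow> \<Phi>\<^sub>1 A n r = 0 \<Longrightarrow> R_Co n A = r"
proof -
  obtain r where r: "r \<in> {0<..<1}" "\<Phi>\<^sub>1 A n r = 0"
    using Phi1_root_exists[OF A n] by auto
  have uniq: "x = r" if "x \<in> {0<..<1}" "\<Phi>\<^sub>1 A n x = 0" for x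
    using Phi1_strict_antimono[OF A n, of x r] Phi1_strict_antimono[OF A n, of r x] r that
    by (cases x r rule: linorder_cases) auto
  have "R_Co n A = r"
    unfolding R_Co_def using r uniq by (metis (mono_tags, lifting) Least_equality order_refl)
  then show "R_Co n A \<in> {0<..<1}" "\<Phi>\<^sub>1 A n (R_Co n A) = 0"
    "\<And>x. x \<in> {0<..<1} \<Longrightarrow> \<Phi>\<^sub>1 A n x = 0 \<Longrightarrow> R_Co n A = x"
    using r uniq by metis+
qed

section \<open>Positivity inside the radius\<close>

lemma Re_T_pos:
  assumes A: "A > 1" and n: "n \<ge> 1" and f: "f \<in> class_S0 n" and z: "norm z < R_Co n A"
  shows "Re (T A f z) > 0"
proof (cases "z = 0")
  case True
  \<comment> \<open>The factor \<open>z\<close> removes the term with \<open>f''\<close>, leaving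
    \<open>2 / (A - 1) * ((A + 1) / 2 - 1)\<close>.\<close>
  have "T A f 0 = 1"
    using A by (simp add: T_def divide_simps)
  with True show ?thesis by simp
next
  case False
  note R = R_Co_props[OF A n]
  define p where "p = (\<lambda>z. if z = 0 then 1 else z * deriv f z / f z)"
  have p: "p \<in> class_P n" and f: "f holomorphic_on \<D>" "\<And>w. w \<in> \<D> - {0} \<Longrightarrow> f w \<noteq> 0"
    using f by (auto simp: class_S0_def class_A_def p_def)
  define r where "r = norm z"
  have r: "0 < r" "r < R_Co n A" "r < 1" "z \<in> \<D>"
    using z False R(1) by (auto simp: r_def)
  define Q where "Q = p z + z * deriv p z / p z"
  have "Re Q \<le> norm Q" by (rule complex_Re_le_cmod)
  also have "\<dots> \<le> (1 + 2 * (real n + 1) * r ^ n + r ^ (2 * n)) / (1 - r ^ (2 * n))"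
    unfolding Q_def r_def by (rule class_P_bound(2)[OF p n \<open>z \<in> \<D>\<close>])
  \<comment> \<open>This says \<open>\<Phi>\<^sub>1 A n r > 0\<close>, by strict decrease towards
    the zero at \<open>R_Co n A\<close>.\<close>
  also have "\<dots> < (A + 1) / 2 * ((1 - r) / (1 + r))"
    using Phi1_strict_antimono[OF A n, of r "R_Co n A"] r R(1,2) by (simp add: \<Phi>\<^sub>1_def)
  also have "\<dots> \<le> (A + 1) / 2 * Re ((1 + z) / (1 - z))"
    using A Re_halfplane_map_ge[of z] r unfolding r_def by (intro mult_left_mono) auto
  finally have "0 < 2 / (A - 1) * ((A + 1) / 2 * Re ((1 + z) / (1 - z)) - Re Q)"
    using A by simp
  also have "\<dots> = Re (of_real (2 / (A - 1)) * (of_real ((A + 1) / 2) * ((1 + z) / (1 - z)) - Q))"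
    by (simp only: Re_complex_of_real minus_complex.sel times_complex.sel Im_complex_of_real) simp
  also have "of_real (2 / (A - 1)) * (of_real ((A + 1) / 2) * ((1 + z) / (1 - z)) - Q) = T A f z"
    unfolding Q_def using False class_P_bound(1)[OF p n \<open>z \<in> \<D>\<close>]
    by (subst T_eq_starlike_quotient[OF f(1) \<open>z \<in> \<D>\<close> False f(2), of p]) (auto simp: p_def)
  finally show ?thesis .
qed

section \<open>The extremal function and sharpness\<close>

text \<open>This solves \<open>z f'(z) / f(z) = (1 + (-z)\<^sup>n) / (1 - (-z)\<^sup>n)\<close>.\<close>

definition extremal :: "nat \<Rightarrow> complex \<Rightarrow> complex"
  where "extremal n z = z * (1 - (-z) ^ n) powr (- (2 / of_nat n))"

lemma norm_power_less_1:
  fixes z :: complex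
  assumes "z \<in> \<D>" and "n \<ge> 1"
  shows "norm ((-z) ^ n) < 1"
  using assms by (simp add: norm_power power_less_one_iff)

text \<open>Keeps the base of the power in \<open>extremal\<close> off the branch cut of the
  principal \<open>powr\<close>.\<close>

lemma one_minus_not_nonpos:
  fixes w :: complex
  assumes "norm w < 1"
  shows "1 - w \<notin> \<real>\<^sub>\<le>\<^sub>0"
  using assms complex_Re_le_cmod[of w] by (auto simp: complex_nonpos_Reals_iff)

text \<open>The power is kept as a factor so that it cancels in \<open>z f' / f\<close>; the formula
  also covers \<open>z = 0\<close>, where it gives the normalization
  \<open>f'(0) = 1\<close>.\<close>

lemma extremal_deriv:
  assumes z: "z \<in> \<D>" and n: "n \<ge> 1"
  shows "(extremal n has_field_derivative
    (1 + (-z) ^ n) / (1 - (-z) ^ n) * (1 - (-z) ^ n) powr (- (2 / of_nat n))) (at z)"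
proof -
  define u where "u = 1 - (-z) ^ n"
  have u: "u \<notin> \<real>\<^sub>\<le>\<^sub>0" and u0: "u \<noteq> 0"
    using one_minus_not_nonpos[OF norm_power_less_1[OF z n]] by (auto simp: u_def)
  have "(-z) * (-z) ^ (n - 1) = (-z) ^ n" using n by (cases n) auto
  then have zn: "z * (-z) ^ (n - 1) = u - 1"
    unfolding u_def by (simp add: minus_equation_iff[of "z * _"])
  have du: "((\<lambda>z. 1 - (-z) ^ n) has_field_derivative of_nat n * (-z) ^ (n - 1)) (at z)"
    by (auto intro!: derivative_eq_intros)
  have "((\<lambda>z. (1 - (-z) ^ n) powr (- (2 / of_nat n))) has_field_derivative
      (- (2 / of_nat n) * u powr (- (2 / of_nat n) - 1)) * (of_nat n * (-z) ^ (n - 1))) (at z)"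
    using DERIV_chain2[OF has_field_derivative_powr du] u unfolding u_def by blast
  from DERIV_mult[OF DERIV_ident this] have "(extremal n has_field_derivative
      u powr (- (2 / of_nat n)) + z * ((- (2 / of_nat n) * u powr (- (2 / of_nat n) - 1)) * (of_nat n * (-z) ^ (n - 1)))) (at z)"
    unfolding extremal_def[abs_def] by (rule DERIV_cong) (simp add: u_def)
  also have "u powr (- (2 / of_nat n)) + z * ((- (2 / of_nat n) * u powr (- (2 / of_nat n) - 1)) * (of_nat n * (-z) ^ (n - 1)))
     = u powr (- (2 / of_nat n)) - 2 * (u powr (- (2 / of_nat n)) / u) * (z * (-z) ^ (n - 1))"
    using n u0 by (simp add: powr_diff)
  \<comment> \<open>By \<open>zn\<close> the factor is \<open>1 - 2 * (u - 1) / u\<close>; its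
    numerator \<open>2 - u\<close> is \<open>1 + (-z) ^ n\<close>.\<close>
  also have "\<dots> = (2 - u) / u * u powr (- (2 / of_nat n))"
    unfolding zn using u0 by (simp add: field_simps)
  finally show ?thesis by (simp add: u_def)
qed

lemma extremal_quotient:
  assumes z: "z \<in> \<D>" "z \<noteq> 0" and n: "n \<ge> 1"
  shows "extremal n z \<noteq> 0"
    and "z * deriv (extremal n) z / extremal n z = (1 + (-z) ^ n) / (1 - (-z) ^ n)"
proof -
  have "1 - (-z) ^ n \<noteq> 0"
    using norm_power_less_1[OF z(1) n] by auto
  then show "extremal n z \<noteq> 0"
    "z * deriv (extremal n) z / extremal n z = (1 + (-z) ^ n) / (1 - (-z) ^ n)"
    using z DERIV_imp_deriv[OF extremal_deriv[OF z(1) n]]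
    by (simp_all add: extremal_def)
qed

lemma halfplane_power_in_class_P:
  assumes n: "n \<ge> 1"
  shows "(\<lambda>z. (1 + (-z) ^ n) / (1 - (-z) ^ n)) \<in> class_P n"
  unfolding class_P_def
proof (intro CollectI conjI)
  have ne: "1 - (-z) ^ n \<noteq> 0" if "z \<in> \<D>" for z :: complex
    using norm_power_less_1[OF that n] by auto
  show "(\<lambda>z::complex. (1 + (-z) ^ n) / (1 - (-z) ^ n)) holomorphic_on \<D>"
    using ne by (auto intro!: holomorphic_intros)
  show "(\<lambda>z. (1 + (-z) ^ n) / (1 - (-z) ^ n)) \<prec>\<^sub>\<D> (\<lambda>z. (1 + z) / (1 - z))"
    unfolding subordinate_def
    using n norm_power_less_1[OF _ n] by (intro exI[of _ "\<lambda>z. (-z) ^ n"]) (auto intro!: holomorphic_intros)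
  \<comment> \<open>Coefficients read off from
    \<open>(1 + w) / (1 - w) - 1 = 2 * (w + w^2 + ...)\<close> with
    \<open>w = (-z) ^ n\<close>.\<close>
  define c :: "nat \<Rightarrow> complex" where "c = (\<lambda>m. if n dvd m then 2 * (-1) ^ m else 0)"
  have "(\<lambda>k. c (n + k) * z ^ (n + k)) sums ((1 + (-z) ^ n) / (1 - (-z) ^ n) - 1)" if z: "z \<in> \<D>" for z
  proof -
    define w where "w = (-z) ^ n"
    have "(\<lambda>j. 2 * w * w ^ j) sums (2 * w * (1 / (1 - w)))"
      using norm_power_less_1[OF z n] by (intro sums_mult geometric_sums) (simp add: w_def)
    also have "2 * w * (1 / (1 - w)) = (1 + w) / (1 - w) - 1"
      using ne[OF z] by (simp add: w_def field_simps)
    also have "(\<lambda>j. 2 * w * w ^ j) = (\<lambda>j. c (n + n * j) * z ^ (n + n * j))"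
      unfolding c_def w_def
      by (simp add: power_add power_minus[of z] power_mult_distrib mult_ac flip: power_mult)
    finally have "(\<lambda>j. c (n + n * j) * z ^ (n + n * j)) sums ((1 + w) / (1 - w) - 1)" .
    \<comment> \<open>The geometric series runs over multiples of \<open>n\<close> only; reindexing
      fills the gaps with zero terms.\<close>
    moreover have "strict_mono (\<lambda>j. n * j)"
      using n by (intro strict_monoI) simp
    moreover have "c (n + k) * z ^ (n + k) = 0" if "k \<notin> range (\<lambda>j. n * j)" for k
      using that by (auto simp: c_def elim!: dvdE)
    ultimately show ?thesis
      unfolding w_def
      using sums_mono_reindex[of "\<lambda>j. n * j" "\<lambda>k. c (n + k) * z ^ (n + k)"] by simp
  qed
  then show "\<exists>c. \<forall>z\<in>\<D>. (\<lambda>k. c (n + k) * z ^ (n + k)) sums ((1 + (-z) ^ n) / (1 - (-z) ^ n) - 1)"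
    by blast
qed

lemma extremal_in_class_S0:
  assumes n: "n \<ge> 1"
  shows "extremal n \<in> class_S0 n"
proof -
  have "(\<lambda>z. if z = 0 then 1 else z * deriv (extremal n) z / extremal n z) \<in> class_P n
     \<longleftrightarrow> (\<lambda>z. (1 + (-z) ^ n) / (1 - (-z) ^ n)) \<in> class_P n" (is "?p \<in> _ \<longleftrightarrow> ?q \<in> _")
  proof -
    \<comment> \<open>Membership in \<open>class_P\<close> depends only on values in the disc; at
      \<open>0\<close> both functions equal \<open>1\<close> because
      \<open>n \<ge> 1\<close>.\<close>
    have eq: "?p z = ?q z" if "z \<in> \<D>" for z
      using extremal_quotient(2)[OF that _ n] n by (auto simp: power_0_left)
    have "?p holomorphic_on \<D> \<longleftrightarrow> ?q holomorphic_on \<D>"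
      using eq by (intro holomorphic_cong) auto
    then show ?thesis
      unfolding class_P_def subordinate_def using eq by auto
  qed
  moreover have "extremal n holomorphic_on \<D>"
    unfolding holomorphic_on_open[OF open_ball] using extremal_deriv[OF _ n] by blast
  moreover have "deriv (extremal n) 0 = 1"
    using DERIV_imp_deriv[OF extremal_deriv[of 0 n]] n by (simp add: power_0_left)
  ultimately show ?thesis
    using halfplane_power_in_class_P[OF n] extremal_quotient(1)[OF _ _ n]
    unfolding class_S0_def class_A_def by (simp add: extremal_def[of n 0])
qed

text \<open>The sign in \<open>(-z) ^ n\<close> makes it the positive number \<open>r ^ n\<close> at
  \<open>z = -r\<close> for every \<open>n\<close>. Thus \<open>p\<close> and
  \<open>z p' / p\<close> attain their bounds at the very point where the half-plane map has least
  real part.\<close>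

lemma T_extremal:
  assumes r: "0 < r" "r < 1" and n: "n \<ge> 1"
  shows "T A (extremal n) (- of_real r) = of_real (2 / (A - 1) * \<Phi>\<^sub>1 A n r)"
proof -
  define z :: complex where "z = - of_real r"
  define p where "p = (\<lambda>z::complex. (1 + (-z) ^ n) / (1 - (-z) ^ n))"
  define s where "s = r ^ n"
  have s: "0 < s" "s < 1" and q: "r ^ (2 * n) = s\<^sup>2"
    unfolding s_def using r n by (auto simp: power_less_one_iff power_even_eq)
  have z: "z \<in> \<D>" "z \<noteq> 0" "(-z) ^ n = of_real s"
    using r by (auto simp: z_def s_def)
  have s1: "1 - complex_of_real s \<noteq> 0" "1 + complex_of_real s \<noteq> 0"
    using s by (metis of_real_1 of_real_diff of_real_eq_0_iff diff_gt_0_iff_gt less_irrefl)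
      (use s in \<open>metis of_real_1 of_real_add of_real_eq_0_iff add_pos_pos zero_less_one less_irrefl\<close>)
  have "(-z) * (-z) ^ (n - 1) = (-z) ^ n" using n by (cases n) auto
  then have zn: "z * (-z) ^ (n - 1) = - of_real s"
    using z by (simp add: minus_equation_iff)
  have "(p has_field_derivative - 2 * (of_nat n * (-z) ^ (n - 1)) / (1 - of_real s)\<^sup>2) (at z)"
    unfolding p_def using s1 z(3)
    by (auto intro!: derivative_eq_intros simp: power2_eq_square algebra_simps)
  then have "deriv p z = - 2 * (of_nat n * (-z) ^ (n - 1)) / (1 - of_real s)\<^sup>2"
    by (rule DERIV_imp_deriv)
  then have "z * deriv p z = 2 * of_nat n * of_real s / (1 - of_real s)\<^sup>2"
    using arg_cong[OF zn, of "\<lambda>x. - 2 * of_nat n * x / (1 - of_real s)\<^sup>2"] by (simp add: mult_ac)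
  moreover have pz: "p z = (1 + of_real s) / (1 - of_real s)"
    by (simp add: p_def z)
  ultimately have "p z + z * deriv p z / p z
      = of_real ((1 + s) / (1 - s) + 2 * n * s / (1 - s)\<^sup>2 / ((1 + s) / (1 - s)))"
    by simp
  also have "(1 + s) / (1 - s) + 2 * n * s / (1 - s)\<^sup>2 / ((1 + s) / (1 - s))
      = (1 + 2 * (real n + 1) * s + s\<^sup>2) / (1 - s\<^sup>2)"
  proof -
    have "1 - s\<^sup>2 = (1 - s) * (1 + s)"
      by (simp add: power2_eq_square algebra_simps)
    then show ?thesis
      using s by (simp add: divide_simps power2_eq_square) (simp add: algebra_simps)
  qed
  finally have Q: "p z + z * deriv p z / p z = of_real ((1 + 2 * (real n + 1) * s + s\<^sup>2) / (1 - s\<^sup>2))" .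
  have "extremal n holomorphic_on \<D>"
    using extremal_in_class_S0[OF n] by (simp add: class_S0_def class_A_def)
  then have "T A (extremal n) z = 2 / (of_real A - 1) *
      ((of_real A + 1) / 2 * ((1 + z) / (1 - z)) - (p z + z * deriv p z / p z))"
    using z s1 extremal_quotient[OF _ _ n]
    by (intro T_eq_starlike_quotient) (auto simp: p_def)
  also have "\<dots> = of_real (2 / (A - 1) * \<Phi>\<^sub>1 A n r)"
    unfolding Q \<Phi>\<^sub>1_def q s_def[symmetric] by (simp add: z_def)
  finally show ?thesis by (simp add: z_def)
qed

theorem theorem2p1:
  fixes A :: real and n :: nat
  assumes "A \<in> {1<..2}" and "n \<ge> 1"
  shows "(R_Co n A \<in> {0<..<1} \<and> \<Phi>\<^sub>1 A n (R_Co n A) = 0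
          \<and> (\<forall>r\<in>{0<..<1}. \<Phi>\<^sub>1 A n r = 0 \<longrightarrow> R_Co n A \<le> r))
    \<and> (\<forall>f\<in>class_S0 n. \<forall>z. norm z < R_Co n A \<longrightarrow> Re (T A f z) > 0)
    \<and> \<not> (\<exists>R'\<in>{R_Co n A<..1}. \<forall>f\<in>class_S0 n. \<forall>z. norm z < R' \<longrightarrow> Re (T A f z) > 0)"
proof -
  have A: "A > 1" and n: "n \<ge> 1" using assms by auto
  note R = R_Co_props[OF A n]
  \<comment> \<open>Any larger \<open>R'\<close> would admit the point \<open>-R_Co n A\<close>,
    where \<open>T\<close> vanishes for the extremal function.\<close>
  have "T A (extremal n) (- of_real (R_Co n A)) = 0"
    using T_extremal[of "R_Co n A" n A] R(1,2) n by simp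
  moreover have "norm (- complex_of_real (R_Co n A)) = R_Co n A"
    using R(1) by simp
  ultimately have "\<not> (\<exists>R'\<in>{R_Co n A<..1}. \<forall>f\<in>class_S0 n. \<forall>z. norm z < R' \<longrightarrow> Re (T A f z) > 0)"
    using extremal_in_class_S0[OF n]
    by (metis greaterThanAtMost_iff less_irrefl zero_complex.sel(1))
  then show ?thesis
    using R(1,2) Re_T_pos[OF A n] eq_refl[OF R(3)] by blast
qed

end
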